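(* For every $\bar a\in(0,1)$, every $k\ge3$ and every $d$-regular graph $H$ on $k$ labelled vertices, the matrix $$Q_H=\tfrac18\Bigl[\bigl(\tfrac{d}{\bar a^2}+\tfrac{k-2-d}{(1-\bar a)^2}\bigr)I+\bigl(\tfrac1{\bar a^2}-\tfrac1{(1-\bar a)^2}\bigr)A_H\Bigr],$$ where $A_H$ is the adjacency matrix of $H$, is positive definite on $\{y\in\mathbb R^k:\sum_iy_i=0\}$, i.e. $y^{\mathsf T}Q_Hy>0$ for every nonzero $y\in\mathbb R^k$ with $\sum_iy_i=0$.
   Context: On $\{y\in\mathbb R^k:\sum_i y_i=0\}$ the quadratic form of $Q_H$ is by definition $y^{\mathsf T}Q_Hy=\sum_{ij\in E(H)}\frac{w_{ij}^2}{2\bar a^2}+\sum_{ij\notin E(H)}\frac{w_{ij}^2}{2(1-\bar a)^2}$ with $w_{ij}=(y_i+y_j)/2$, sums being over unordered pairs of distinct vertices; this agrees there with the displayed matrix expression. *)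

theory Defs
  imports "HOL-Analysis.Analysis"
begin

text \<open>
  The \<open>k\<close> labelled vertices are the elements of a finite type \<open>'v\<close>, so \<open>k = CARD('v)\<close>.
  A simple graph is given by its edge set, a set of unordered pairs of distinct vertices.
\<close>

definition simple_graph :: "'v set set \<Rightarrow> bool" where
  "simple_graph E \<longleftrightarrow> (\<forall>e\<in>E. card e = 2)"

definition vertex_degree :: "'v set set \<Rightarrow> 'v \<Rightarrow> nat" where
  "vertex_degree E v = card {e \<in> E. v \<in> e}"

definition regular_graph :: "nat \<Rightarrow> 'v set set \<Rightarrow> bool" where
  "regular_graph d E \<longleftrightarrow> simple_graph E \<and> (\<forall>v. vertex_degree E v = d)"

text \<open>The diagonal is zero for a simple graph, since \<open>{i, i}\<close> has only one element.\<close>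

definition adjacency_matrix :: "'v::finite set set \<Rightarrow> real ^ 'v ^ 'v" where
  "adjacency_matrix E = (\<chi> i j. if {i, j} \<in> E then 1 else 0)"

text \<open>
  The subtraction \<open>k - 2 - d\<close> is taken in the reals: it equals \<open>-1\<close> for the complete graph.
\<close>

definition Q_matrix :: "real \<Rightarrow> nat \<Rightarrow> 'v::finite set set \<Rightarrow> real ^ 'v ^ 'v" where
  "Q_matrix a d E =
     (1 / 8) *\<^sub>R
       ((real d / a\<^sup>2 + (real CARD('v) - 2 - real d) / (1 - a)\<^sup>2) *\<^sub>R mat 1
        + (1 / a\<^sup>2 - 1 / (1 - a)\<^sup>2) *\<^sub>R adjacency_matrix E)"

end

theory Submission
  imports Defs
begin

text \<open>
  Put \<open>\<alpha> = 1 / a\<^sup>2\<close> and \<open>\<beta> = 1 / (1 - a)\<^sup>2\<close>. For a symmetric matrix \<open>M\<close> with constant row sum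
  \<open>r\<close>, expanding squares gives
  \<open>\<Sum>i j. M\<^sub>i\<^sub>j (y\<^sub>i + y\<^sub>j)\<^sup>2 = 2 r (y \<bullet> y) + 2 (y \<bullet> M y)\<close> (lemma \<open>sum_weighted_pair_squares\<close>).
  The adjacency matrix \<open>A\<close> of the given graph has row sum \<open>d\<close>, and that of the complete graph,
  \<open>C\<close>, has row sum \<open>k - 1\<close> and acts as \<open>-1\<close> on vectors of coordinate sum zero. So for such \<open>y\<close>
  the identities for \<open>A\<close> and \<open>C\<close> combine into
  \<open>16 (y \<bullet> Q y) = \<Sum>i j. (\<alpha> A\<^sub>i\<^sub>j + \<beta> (C\<^sub>i\<^sub>j - A\<^sub>i\<^sub>j)) (y\<^sub>i + y\<^sub>j)\<^sup>2\<close>: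
  edges have weight \<open>\<alpha>\<close>, non-edges have weight \<open>\<beta>\<close>.

  Replacing every weight by \<open>min \<alpha> \<beta> > 0\<close> only decreases the sum and leaves
  \<open>min \<alpha> \<beta>\<close> times the sum for the complete graph, which is \<open>2 (k - 2) (y \<bullet> y)\<close>.
  This is positive because \<open>k \<ge> 3\<close> and \<open>y \<noteq> 0\<close>.
\<close>

lemma sum_weighted_pair_squares:
  fixes M :: "real ^ 'n::finite ^ 'n"
  assumes sym: "\<And>i j. M $ i $ j = M $ j $ i"
    and row: "\<And>i. (\<Sum>j\<in>UNIV. M $ i $ j) = r"
  shows "(\<Sum>i\<in>UNIV. \<Sum>j\<in>UNIV. M $ i $ j * (y $ i + y $ j)\<^sup>2)
           = 2 * r * (y \<bullet> y) + 2 * (y \<bullet> (M *v y))"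
proof -
  have "(\<Sum>i\<in>UNIV. \<Sum>j\<in>UNIV. M $ i $ j * (y $ i + y $ j)\<^sup>2)
      = (\<Sum>i\<in>UNIV. \<Sum>j\<in>UNIV. M $ i $ j * (y $ i)\<^sup>2)
        + (\<Sum>i\<in>UNIV. \<Sum>j\<in>UNIV. M $ i $ j * (y $ j)\<^sup>2)
        + 2 * (\<Sum>i\<in>UNIV. \<Sum>j\<in>UNIV. y $ i * (M $ i $ j * y $ j))"
    by (simp add: sum.distrib sum_distrib_left power2_sum algebra_simps)
  also have "(\<Sum>i\<in>UNIV. \<Sum>j\<in>UNIV. M $ i $ j * (y $ j)\<^sup>2)
      = (\<Sum>i\<in>UNIV. \<Sum>j\<in>UNIV. M $ i $ j * (y $ i)\<^sup>2)"
    by (subst sum.swap) (simp add: sym)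
  also have "(\<Sum>i\<in>UNIV. \<Sum>j\<in>UNIV. M $ i $ j * (y $ i)\<^sup>2) = r * (y \<bullet> y)"
    by (simp add: sum_distrib_right [symmetric] row inner_vec_def sum_distrib_left power2_eq_square)
  also have "(\<Sum>i\<in>UNIV. \<Sum>j\<in>UNIV. y $ i * (M $ i $ j * y $ j)) = y \<bullet> (M *v y)"
    by (simp add: inner_vec_def matrix_vector_mult_def sum_distrib_left)
  finally show ?thesis by simp
qed

lemma adjacency_matrix_sym: "adjacency_matrix E $ i $ j = adjacency_matrix E $ j $ i"
  by (simp add: adjacency_matrix_def insert_commute)

text \<open>An edge of a simple graph containing \<open>i\<close> is determined by its other endpoint.\<close>

lemma row_sum_adjacency_matrix:
  fixes E :: "'v::finite set set"
  assumes "simple_graph E"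
  shows "(\<Sum>j\<in>UNIV. adjacency_matrix E $ i $ j) = real (vertex_degree E i)"
proof -
  have "bij_betw (\<lambda>j. {i, j}) {j. {i, j} \<in> E} {e \<in> E. i \<in> e}"
    unfolding bij_betw_def
  proof
    show "inj_on (\<lambda>j. {i, j}) {j. {i, j} \<in> E}"
      by (auto simp: inj_on_def doubleton_eq_iff)
    show "(\<lambda>j. {i, j}) ` {j. {i, j} \<in> E} = {e \<in> E. i \<in> e}"
    proof safe
      fix e assume e: "e \<in> E" "i \<in> e"
      then have "card e = 2" using assms by (simp add: simple_graph_def)
      then obtain j where "e = {i, j}"
        using e(2) by (auto simp: card_2_iff)
      then show "e \<in> (\<lambda>j. {i, j}) ` {j. {i, j} \<in> E}" using e by auto
    qed
  qed
  then have "card {j. {i, j} \<in> E} = vertex_degree E i"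
    unfolding vertex_degree_def by (rule bij_betw_same_card)
  then show ?thesis
    by (simp add: adjacency_matrix_def sum.If_cases)
qed

lemma sum_adjacent_pair_squares:
  fixes E :: "'v::finite set set"
  assumes "regular_graph d E"
  shows "(\<Sum>i\<in>UNIV. \<Sum>j\<in>UNIV. adjacency_matrix E $ i $ j * (y $ i + y $ j)\<^sup>2)
           = 2 * real d * (y \<bullet> y) + 2 * (y \<bullet> (adjacency_matrix E *v y))"
  using assms
  by (intro sum_weighted_pair_squares adjacency_matrix_sym)
     (simp add: regular_graph_def row_sum_adjacency_matrix)

lemma adjacency_matrix_complete:
  "adjacency_matrix {e :: 'v::finite set. card e = 2} $ i $ j = (if i = j then 0 else 1)"
  by (simp add: adjacency_matrix_def card_insert_if)

text \<open>
  The adjacency matrix of the complete graph is the all-ones matrix minus the identity, and the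
  all-ones matrix kills a vector of coordinate sum zero.
\<close>

lemma sum_distinct_pair_squares:
  fixes y :: "real ^ 'v::finite"
  assumes "(\<Sum>i\<in>UNIV. y $ i) = 0"
  shows "(\<Sum>i\<in>UNIV. \<Sum>j\<in>UNIV.
            adjacency_matrix {e :: 'v set. card e = 2} $ i $ j * (y $ i + y $ j)\<^sup>2)
           = 2 * (real CARD('v) - 2) * (y \<bullet> y)"
proof -
  let ?C = "adjacency_matrix {e :: 'v set. card e = 2}"
  have row: "(\<Sum>j\<in>UNIV. ?C $ i $ j) = real CARD('v) - 1" for i
    by (simp add: adjacency_matrix_complete sum.If_cases Compl_eq_Diff_UNIV
        card_Diff_singleton of_nat_diff)
  have "?C *v y = - y"
  proof (rule vec_eq_iff [THEN iffD2], rule allI)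
    fix i
    have "(\<Sum>j\<in>UNIV. ?C $ i $ j * y $ j) = (\<Sum>j\<in>UNIV. y $ j - (if j = i then y $ j else 0))"
      by (intro sum.cong) (auto simp: adjacency_matrix_complete)
    also have "\<dots> = - y $ i"
      using assms by (simp add: sum_subtractf)
    finally show "(?C *v y) $ i = (- y) $ i"
      by (simp add: matrix_vector_mult_def)
  qed
  then show ?thesis
    using sum_weighted_pair_squares [of ?C, OF adjacency_matrix_sym row, of y]
    by (simp add: algebra_simps)
qed

text \<open>
  The factor 16 is the 8 in the definition of the matrix times 2 for counting ordered pairs.
\<close>

lemma Q_matrix_quadratic_form:
  fixes y :: "real ^ 'v::finite" and E :: "'v set set"
  assumes "regular_graph d E" and "(\<Sum>i\<in>UNIV. y $ i) = 0"
  shows "16 * (y \<bullet> (Q_matrix a d E *v y)) =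
    (\<Sum>i\<in>UNIV. \<Sum>j\<in>UNIV.
       (1 / a\<^sup>2 * adjacency_matrix E $ i $ j
        + 1 / (1 - a)\<^sup>2 * (adjacency_matrix {e. card e = 2} $ i $ j - adjacency_matrix E $ i $ j))
       * (y $ i + y $ j)\<^sup>2)"
    (is "_ = (\<Sum>i\<in>UNIV. \<Sum>j\<in>UNIV. (?\<alpha> * ?A $ i $ j + ?\<beta> * (?C $ i $ j - ?A $ i $ j)) * _)")
proof -
  let ?S = "\<lambda>M :: real ^ 'v ^ 'v. \<Sum>i\<in>UNIV. \<Sum>j\<in>UNIV. M $ i $ j * (y $ i + y $ j)\<^sup>2"
  define \<alpha> \<beta> where "\<alpha> = ?\<alpha>" and "\<beta> = ?\<beta>"
  have "(\<Sum>i\<in>UNIV. \<Sum>j\<in>UNIV. (\<alpha> * ?A $ i $ j + \<beta> * (?C $ i $ j - ?A $ i $ j)) * (y $ i + y $ j)\<^sup>2)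
      = \<alpha> * ?S ?A + \<beta> * (?S ?C - ?S ?A)"
    unfolding sum_distrib_left sum_subtractf [symmetric] sum.distrib [symmetric]
    by (intro sum.cong refl) (simp add: algebra_simps)
  also have "\<dots> = \<alpha> * (2 * real d * (y \<bullet> y) + 2 * (y \<bullet> (?A *v y)))
      + \<beta> * (2 * (real CARD('v) - 2) * (y \<bullet> y)
             - (2 * real d * (y \<bullet> y) + 2 * (y \<bullet> (?A *v y))))"
    by (simp only: sum_adjacent_pair_squares [OF assms(1)] sum_distinct_pair_squares [OF assms(2)])
  also have "\<dots> = 16 * (y \<bullet> (Q_matrix a d E *v y))"
  proof -
    have "Q_matrix a d E = (1 / 8) *\<^sub>R ((real d * \<alpha> + (real CARD('v) - 2 - real d) * \<beta>) *\<^sub>R mat 1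
        + (\<alpha> - \<beta>) *\<^sub>R ?A)"
      by (simp add: Q_matrix_def \<alpha>_def \<beta>_def)
    then show ?thesis
      by (simp add: scaleR_matrix_vector_assoc [symmetric] matrix_vector_mult_add_rdistrib
          inner_add_right) (simp add: algebra_simps)
  qed
  finally show ?thesis by (simp add: \<alpha>_def \<beta>_def)
qed

theorem lemma3p1:
  fixes a :: real and d :: nat and E :: "'v::finite set set"
  assumes "0 < a" and "a < 1"
    and "CARD('v) \<ge> 3"
    and "regular_graph d E"
  shows "\<forall>y :: real ^ 'v. y \<noteq> 0 \<and> (\<Sum>i\<in>UNIV. y $ i) = 0 \<longrightarrow> y \<bullet> (Q_matrix a d E *v y) > 0"
proof (intro allI impI, elim conjE)
  fix y :: "real ^ 'v"
  assume y: "y \<noteq> 0" and sum0: "(\<Sum>i\<in>UNIV. y $ i) = 0"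
  let ?A = "adjacency_matrix E"
  let ?C = "adjacency_matrix {e :: 'v set. card e = 2}"
  define \<alpha> \<beta> where "\<alpha> = 1 / a\<^sup>2" and "\<beta> = 1 / (1 - a)\<^sup>2"
  define \<gamma> where "\<gamma> = min \<alpha> \<beta>"
  have "\<gamma> > 0" using assms(1,2) by (simp add: \<gamma>_def \<alpha>_def \<beta>_def)
  have weight: "\<gamma> * ?C $ i $ j \<le> \<alpha> * ?A $ i $ j + \<beta> * (?C $ i $ j - ?A $ i $ j)" for i j
  proof -
    \<comment> \<open>On the diagonal both sides vanish, as the graph has no loops.\<close>
    have "{i} \<notin> E" using assms(4) by (force simp: regular_graph_def simple_graph_def)
    then show ?thesis
      unfolding adjacency_matrix_complete by (auto simp: \<gamma>_def adjacency_matrix_def)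
  qed
  have "0 < \<gamma> * (2 * (real CARD('v) - 2) * (y \<bullet> y))"
    using \<open>\<gamma> > 0\<close> y assms(3) by simp
  also have "\<dots> = (\<Sum>i\<in>UNIV. \<Sum>j\<in>UNIV. (\<gamma> * ?C $ i $ j) * (y $ i + y $ j)\<^sup>2)"
    unfolding sum_distinct_pair_squares [OF sum0, symmetric]
    by (simp add: sum_distrib_left mult.assoc)
  also have "\<dots> \<le> (\<Sum>i\<in>UNIV. \<Sum>j\<in>UNIV.
      (\<alpha> * ?A $ i $ j + \<beta> * (?C $ i $ j - ?A $ i $ j)) * (y $ i + y $ j)\<^sup>2)"
    by (intro sum_mono mult_right_mono weight) simp
  also have "\<dots> = 16 * (y \<bullet> (Q_matrix a d E *v y))"
    unfolding \<alpha>_def \<beta>_def by (rule Q_matrix_quadratic_form [OF assms(4) sum0, symmetric])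
  finally show "y \<bullet> (Q_matrix a d E *v y) > 0" by simp
qed

end
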